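(* Let $p$ be a prime, $\ell\ge1$, and let $f\in P_{p^\ell}$ be idempotent with idempotency index $\eta$ and generating vector $(e_0,\dots,e_{\eta-1})$. For every $s\ge1$, $$\Sigma^sf=\Delta^{\overline{-s}}f-\sum_{j=0}^{s-1}\Sigma^j[e_{\overline{j-s}}],$$ and this is the decomposition of $\Sigma^sf$ into its idempotent part $\Delta^{\overline{-s}}f$ and its nilpotent part $-\sum_{j=0}^{s-1}\Sigma^j[e_{\overline{j-s}}]$. Moreover, if $e_\gamma$ is the leading component of the generating vector, then $\tau(\Sigma^sf)=\mathrm{lcm}\big(\tau(f),\tau(\Sigma^{s-\eta+\gamma}[e_\gamma])\big)$ for all sufficiently large $s$.
   Context: $P_{p^\ell}$ is the module of periodic sequences $\mathbb{N}\to\mathbb{Z}_{p^\ell}$, and $\tau$ is the minimal period. $\Delta f(n)=f(n+1)-f(n)$. Idempotent means $\Delta^\eta f=f$ for some $\eta\ge1$ (minimal such $\eta$: idempotency index); nilpotent means $\Delta^\eta g=0$ for some $\eta\ge1$. The generating vector has entries $e_i=\Delta^if(0)$, $0\le i<\eta$. Its leading component is the last entry with minimal $p$-adic valuation, where the valuation of $0$ is $\infty$. For $z\in\mathbb{Z}$, $\overline z\in\{0,\dots,\eta-1\}$ is the remainder of $z$ modulo $\eta$. $[c]$ is the constant sequence. $\Sigma$ is the sum operator $\Sigma f(0)=0$, $\Sigma f(n)=f(n-1)+\Sigma f(n-1)$, and $\Sigma^0=\mathrm{id}$. *)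

theory Defs
  imports
    "Berlekamp_Zassenhaus.Finite_Field"
    "HOL-Library.Extended_Nat"
    Complex_Main
begin

text \<open>
  The ring \<open>\<int>/p\<^sup>l\<close> is the library type \<open>'m mod_ring\<close> for an index type with
  \<open>CARD('m) = p ^ l\<close>; a sequence is a function \<open>nat \<Rightarrow> 'm mod_ring\<close>.
\<close>

definition is_period :: "(nat \<Rightarrow> 'a) \<Rightarrow> nat \<Rightarrow> bool" where
  "is_period f t \<longleftrightarrow> t \<ge> 1 \<and> (\<forall>n. f (n + t) = f n)"

definition periodic_seqs :: "(nat \<Rightarrow> 'a) set" where
  "periodic_seqs = {f. \<exists>t. is_period f t}"

definition min_period :: "(nat \<Rightarrow> 'a) \<Rightarrow> nat" where
  "min_period f = (LEAST t. is_period f t)"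

definition diff_op :: "(nat \<Rightarrow> 'a) \<Rightarrow> nat \<Rightarrow> 'a :: ab_group_add" where
  "diff_op f = (\<lambda>n. f (n + 1) - f n)"

primrec sum_op :: "(nat \<Rightarrow> 'a) \<Rightarrow> nat \<Rightarrow> 'a :: ab_group_add" where
  "sum_op f 0 = 0"
| "sum_op f (Suc n) = f n + sum_op f n"

definition const_seq :: "'a \<Rightarrow> nat \<Rightarrow> 'a" where
  "const_seq c = (\<lambda>_. c)"

definition idempotent_seq :: "(nat \<Rightarrow> 'a :: ab_group_add) \<Rightarrow> bool" where
  "idempotent_seq f \<longleftrightarrow> (\<exists>k\<ge>1. (diff_op ^^ k) f = f)"

definition idempotency_index :: "(nat \<Rightarrow> 'a :: ab_group_add) \<Rightarrow> nat" where
  "idempotency_index f = (LEAST k. k \<ge> 1 \<and> (diff_op ^^ k) f = f)"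

definition nilpotent_seq :: "(nat \<Rightarrow> 'a :: ab_group_add) \<Rightarrow> bool" where
  "nilpotent_seq f \<longleftrightarrow> (\<exists>k\<ge>1. (diff_op ^^ k) f = const_seq 0)"

definition decomposes_into ::
  "(nat \<Rightarrow> 'a :: ab_group_add) \<Rightarrow> (nat \<Rightarrow> 'a) \<Rightarrow> (nat \<Rightarrow> 'a) \<Rightarrow> bool" where
  "decomposes_into h a b \<longleftrightarrow>
     h \<in> periodic_seqs \<and>
     a \<in> periodic_seqs \<and> idempotent_seq a \<and>
     b \<in> periodic_seqs \<and> nilpotent_seq b \<and>
     h = (\<lambda>n. a n + b n)"

definition is_the_decomposition ::
  "(nat \<Rightarrow> 'a :: ab_group_add) \<Rightarrow> (nat \<Rightarrow> 'a) \<Rightarrow> (nat \<Rightarrow> 'a) \<Rightarrow> bool" where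
  "is_the_decomposition h a b \<longleftrightarrow>
     decomposes_into h a b \<and> (\<forall>a' b'. decomposes_into h a' b' \<longrightarrow> a' = a \<and> b' = b)"

definition generating_vector :: "(nat \<Rightarrow> 'a :: ab_group_add) \<Rightarrow> 'a list" where
  "generating_vector f = map (\<lambda>i. (diff_op ^^ i) f 0) [0..<idempotency_index f]"

text \<open>
  For \<open>CARD('m) = p ^ l\<close> the valuation of a nonzero residue class does not depend on the chosen
  integer representative; \<open>to_int_mod_ring\<close> picks the one in \<open>{0..<p ^ l}\<close>.
\<close>

definition padic_val :: "nat \<Rightarrow> 'm :: finite mod_ring \<Rightarrow> enat" where
  "padic_val p x = (if x = 0 then \<infinity> else enat (multiplicity (int p) (to_int_mod_ring x)))"

definition has_minimal_val :: "nat \<Rightarrow> 'm :: finite mod_ring list \<Rightarrow> nat \<Rightarrow> bool" where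
  "has_minimal_val p e i \<longleftrightarrow>
     i < length e \<and> (\<forall>j<length e. padic_val p (e ! i) \<le> padic_val p (e ! j))"

definition is_leading_index :: "nat \<Rightarrow> 'm :: finite mod_ring list \<Rightarrow> nat \<Rightarrow> bool" where
  "is_leading_index p e i \<longleftrightarrow>
     has_minimal_val p e i \<and> (\<forall>j. has_minimal_val p e j \<longrightarrow> j \<le> i)"

definition residue :: "nat \<Rightarrow> int \<Rightarrow> nat" where
  "residue k z = nat (z mod int k)"

end

theory Submission
  imports Defs
begin

text \<open>
  Summation inverts the difference operator up to a constant, which gives the formula by induction;
  uniqueness of the idempotent-nilpotent decomposition and its compatibility with shifts show that
  the minimal period of \<open>\<Sigma>\<^sup>s f\<close> is the least common multiple of the minimal periods of its two parts.
  The idempotent part has the period of \<open>f\<close>. The \<open>i\<close>-th Newton coefficient of the nilpotent part is,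
  up to sign, an entry of the generating vector, repeated periodically. A sequence with Newton
  coefficients \<open>c\<^sub>i\<close> has period \<open>t\<close> iff \<open>\<Sum>\<^sub>i\<^sub>\<ge>\<^sub>1 (t choose i) c\<^sub>i\<^sub>+\<^sub>j = 0\<close> for all \<open>j\<close>. Comparing
  \<open>p\<close>-adic valuations for \<open>t\<close> a power of \<open>p\<close> shows that the minimal period is determined by the last
  coefficient of minimal valuation, provided that its index is large compared with the number of
  coefficients after it.
\<close>

section \<open>Iterated differences and sums\<close>

lemma diff_op_add: "diff_op (\<lambda>n. g n + h n) = (\<lambda>n. diff_op g n + diff_op h n)"
  by (simp add: diff_op_def fun_eq_iff)

lemma diff_op_pow_add:
  "(diff_op ^^ k) (\<lambda>n. g n + h n) = (\<lambda>n. (diff_op ^^ k) g n + (diff_op ^^ k) h n)"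
  by (induction k) (simp_all add: diff_op_add)

lemma diff_op_pow_diff:
  "(diff_op ^^ k) (\<lambda>n. g n - h n) = (\<lambda>n. (diff_op ^^ k) g n - (diff_op ^^ k) h n)"
  by (induction k) (simp_all add: diff_op_def fun_eq_iff)

lemma diff_op_pow_shift:
  "(diff_op ^^ k) (\<lambda>n. g (n + t)) = (\<lambda>n. (diff_op ^^ k) g (n + t))"
  by (induction k) (simp_all add: diff_op_def fun_eq_iff)

lemma diff_op_pow_zero: "(diff_op ^^ k) (const_seq 0) = const_seq 0"
  by (induction k) (simp_all add: diff_op_def const_seq_def)

lemma diff_op_pow_mult:
  assumes "(diff_op ^^ k) g = g"
  shows "(diff_op ^^ (k * q)) g = g"
  by (induction q) (simp_all add: funpow_add assms)

lemma diff_op_pow_mod: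
  assumes "(diff_op ^^ k) g = g"
  shows "(diff_op ^^ (i mod k)) g = (diff_op ^^ i) g"
proof -
  have "(diff_op ^^ i) g = (diff_op ^^ (i mod k + k * (i div k))) g"
    by simp
  also have "\<dots> = (diff_op ^^ (i mod k)) g"
    by (simp only: funpow_add o_apply diff_op_pow_mult[OF assms])
  finally show ?thesis by simp
qed

lemma diff_op_pow_eq_zero_mono:
  assumes "(diff_op ^^ k) g = const_seq 0" and "k \<le> i"
  shows "(diff_op ^^ i) g = const_seq 0"
proof -
  have "(diff_op ^^ (i - k + k)) g = const_seq 0"
    by (simp only: funpow_add o_apply assms diff_op_pow_zero)
  then show ?thesis using assms by simp
qed

lemma diff_sum_op: "diff_op (sum_op g) = g"
  by (simp add: diff_op_def fun_eq_iff)

lemma sum_diff_op: "sum_op (diff_op g) n = g n - g 0"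
  by (induction n) (simp_all add: diff_op_def)

lemma sum_op_diff: "sum_op (\<lambda>n. g n - h n) n = sum_op g n - sum_op h n"
  by (induction n) simp_all

lemma sum_op_sum: "sum_op (\<lambda>n. \<Sum>j\<in>A. h j n) n = (\<Sum>j\<in>A. sum_op (h j) n)"
  by (induction n) (simp_all add: sum.distrib)

lemma diff_op_pow_sum_op_pow: "(diff_op ^^ k) ((sum_op ^^ k) g) = g"
proof (induction k arbitrary: g)
  case (Suc k)
  have "(diff_op ^^ Suc k) ((sum_op ^^ Suc k) g) = (diff_op ^^ k) (diff_op (sum_op ((sum_op ^^ k) g)))"
    by (simp only: funpow_Suc_right o_apply) (simp add: funpow_swap1)
  then show ?case by (simp add: diff_sum_op Suc)
qed simp

lemma diff_op_pow_sum_op_pow_le: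
  assumes "i \<le> k"
  shows "(diff_op ^^ i) ((sum_op ^^ k) g) = (sum_op ^^ (k - i)) g"
proof -
  have "(sum_op ^^ k) g = (sum_op ^^ i) ((sum_op ^^ (k - i)) g)"
    using assms by (metis comp_apply funpow_add le_add_diff_inverse)
  then show ?thesis by (simp add: diff_op_pow_sum_op_pow)
qed

lemma diff_op_pow_sum_op_pow_ge:
  assumes "k \<le> i"
  shows "(diff_op ^^ i) ((sum_op ^^ k) g) = (diff_op ^^ (i - k)) g"
proof -
  have "(diff_op ^^ i) ((sum_op ^^ k) g) = (diff_op ^^ (i - k)) ((diff_op ^^ k) ((sum_op ^^ k) g))"
    using assms by (metis comp_apply funpow_add le_add_diff_inverse2)
  then show ?thesis by (simp add: diff_op_pow_sum_op_pow)
qed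

lemma sum_op_pow_at_zero: "k \<ge> 1 \<Longrightarrow> (sum_op ^^ k) g 0 = 0"
  by (cases k) simp_all

text \<open>\<open>(sum_op ^^ k) (const_seq c)\<close> maps \<open>n\<close> to the
  \<open>n choose k\<close>-fold multiple of \<open>c\<close>, so its only possibly nonzero Newton
  coefficient is \<open>c\<close>, at index \<open>k\<close>.\<close>

lemma diff_op_pow_sum_op_pow_const_at_zero:
  "(diff_op ^^ i) ((sum_op ^^ k) (const_seq c)) 0 = (if i = k then c else 0)"
proof -
  consider "i < k" | "i = k" | d where "i = k + Suc d"
    by (metis less_iff_Suc_add linorder_neqE_nat add_Suc_right)
  then show ?thesis
  proof cases
    case 1
    then show ?thesis by (simp add: diff_op_pow_sum_op_pow_le sum_op_pow_at_zero)
  next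
    case 2
    then show ?thesis by (simp add: diff_op_pow_sum_op_pow const_seq_def)
  next
    case 3
    have "diff_op (const_seq c) = const_seq 0"
      by (simp add: diff_op_def const_seq_def)
    then have "(diff_op ^^ Suc d) (const_seq c) = const_seq 0"
      by (simp only: funpow_Suc_right o_apply diff_op_pow_zero)
    moreover have "(diff_op ^^ i) ((sum_op ^^ k) (const_seq c)) = (diff_op ^^ Suc d) (const_seq c)"
      using 3 by (subst diff_op_pow_sum_op_pow_ge) auto
    ultimately show ?thesis using 3 by (simp add: const_seq_def)
  qed
qed

text \<open>Pascal's rule, applied to \<open>g (Suc n) = g n + diff_op g n\<close>; the induction
  hypothesis is needed for \<open>diff_op g\<close> as well, hence \<open>g\<close> is
  generalised.\<close>

lemma newton_expansion:
  fixes g :: "nat \<Rightarrow> 'a :: comm_ring_1"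
  shows "g n = (\<Sum>i\<le>n. of_nat (n choose i) * (diff_op ^^ i) g 0)"
proof (induction n arbitrary: g)
  case (Suc n)
  let ?d = "\<lambda>i. (diff_op ^^ i) g 0"
  have "g (Suc n) = g n + diff_op g n"
    by (simp add: diff_op_def)
  also have "g n = (\<Sum>i\<le>Suc n. of_nat (n choose i) * ?d i)"
    by (simp add: Suc[of g] binomial_eq_0)
  also have "\<dots> = ?d 0 + (\<Sum>i\<le>n. of_nat (n choose Suc i) * ?d (Suc i))"
    by (simp only: sum.atMost_Suc_shift) simp
  also have "diff_op g n = (\<Sum>i\<le>n. of_nat (n choose i) * ?d (Suc i))"
    by (subst Suc) (simp add: funpow_swap1)
  also have "?d 0 + (\<Sum>i\<le>n. of_nat (n choose Suc i) * ?d (Suc i))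
      + (\<Sum>i\<le>n. of_nat (n choose i) * ?d (Suc i))
      = ?d 0 + (\<Sum>i\<le>n. of_nat (Suc n choose Suc i) * ?d (Suc i))"
    by (simp add: sum.distrib algebra_simps)
  also have "\<dots> = (\<Sum>i\<le>Suc n. of_nat (Suc n choose i) * ?d i)"
    by (simp only: sum.atMost_Suc_shift) simp
  finally show ?case .
qed simp

section \<open>Periods\<close>

lemma is_period_mult:
  assumes "is_period g t" and "q \<ge> 1"
  shows "is_period g (t * q)"
proof -
  have "g (n + t * q) = g n" for n
    using assms(1) by (induction q) (simp_all add: is_period_def add.assoc[symmetric] add.commute[of t])
  then show ?thesis using assms by (simp add: is_period_def)
qed

lemma is_period_min_period:
  assumes "g \<in> periodic_seqs"
  shows "is_period g (min_period g)"
  using assms unfolding periodic_seqs_def min_period_def by (auto intro: LeastI_ex)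

text \<open>The remainder of a period modulo the minimal one would, if nonzero, be a smaller
  period.\<close>

lemma is_period_iff_min_period_dvd:
  assumes "g \<in> periodic_seqs"
  shows "is_period g t \<longleftrightarrow> t \<ge> 1 \<and> min_period g dvd t"
proof
  let ?m = "min_period g"
  have m: "is_period g ?m" by (rule is_period_min_period[OF assms])
  assume t: "is_period g t"
  have "t mod ?m = 0"
  proof (rule ccontr)
    assume nz: "t mod ?m \<noteq> 0"
    have "g (n + t mod ?m) = g n" for n
    proof (cases "t div ?m = 0")
      case True
      then have "t mod ?m = t"
        by (metis add_0 mult_0 div_mult_mod_eq)
      then show ?thesis using t by (simp add: is_period_def)
    next
      case False
      then have "g (n + t mod ?m) = g (n + t mod ?m + ?m * (t div ?m))"
        using is_period_mult[OF m, of "t div ?m"] unfolding is_period_def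
        by (metis One_nat_def Suc_leI neq0_conv)
      also have "\<dots> = g (n + t)"
        by (metis add.assoc mod_mult_div_eq)
      finally show ?thesis using t by (simp add: is_period_def)
    qed
    then have "is_period g (t mod ?m)" using nz by (simp add: is_period_def)
    then have "?m \<le> t mod ?m" unfolding min_period_def by (rule Least_le)
    moreover have "t mod ?m < ?m" using m by (simp add: is_period_def)
    ultimately show False by simp
  qed
  then show "t \<ge> 1 \<and> ?m dvd t" using t by (auto simp: is_period_def)
next
  assume "t \<ge> 1 \<and> min_period g dvd t"
  then show "is_period g t"
    using is_period_mult[OF is_period_min_period[OF assms]] by (auto elim!: dvdE)
qed

lemma min_period_cong:
  assumes "\<And>t. is_period g t \<longleftrightarrow> is_period h t"
  shows "min_period g = min_period h"
  by (simp add: min_period_def assms)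

lemma min_period_eq_lcm:
  assumes "a \<in> periodic_seqs" and "b \<in> periodic_seqs"
    and "\<And>t. is_period h t \<longleftrightarrow> is_period a t \<and> is_period b t"
  shows "min_period h = lcm (min_period a) (min_period b)"
proof -
  have pos: "min_period a \<ge> 1" "min_period b \<ge> 1"
    using is_period_min_period assms(1,2) by (auto simp: is_period_def)
  have "is_period h t \<longleftrightarrow> t \<ge> 1 \<and> lcm (min_period a) (min_period b) dvd t" for t
    using assms by (auto simp: is_period_iff_min_period_dvd)
  moreover have "lcm (min_period a) (min_period b) \<ge> 1"
    using pos lcm_pos_nat[of "min_period a" "min_period b"] by simp
  ultimately show ?thesis
    unfolding min_period_def[of h] by (intro Least_equality) (simp_all add: dvd_imp_le)
qed

text \<open>The minimal period divides \<open>p ^ Suc a\<close>, so it is a power of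
  \<open>p\<close>; an exponent of at most \<open>a\<close> would make \<open>p ^ a\<close> a
  period.\<close>

lemma min_period_eq_prime_power:
  assumes "prime p" and "is_period g (p ^ Suc a)" and "\<not> is_period g (p ^ a)"
  shows "min_period g = p ^ Suc a"
proof -
  have g: "g \<in> periodic_seqs" using assms(2) by (auto simp: periodic_seqs_def)
  have "min_period g dvd p ^ Suc a" using assms(2) g by (simp add: is_period_iff_min_period_dvd)
  then obtain b where b: "b \<le> Suc a" "min_period g = p ^ b"
    using divides_primepow_nat[OF assms(1)] by blast
  have "\<not> p ^ b dvd p ^ a"
    using assms(1,3) b(2) by (simp add: is_period_iff_min_period_dvd[OF g] prime_gt_0_nat Suc_le_eq)
  then have "b = Suc a" using b(1) le_imp_power_dvd[of b a p] by linarith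
  then show ?thesis using b by simp
qed

lemma is_period_diff_op_pow:
  assumes "is_period g t"
  shows "is_period ((diff_op ^^ k) g) t"
proof -
  have "(\<lambda>n. g (n + t)) = g" using assms by (simp add: is_period_def)
  then show ?thesis
    using assms diff_op_pow_shift[of k g t] by (simp add: is_period_def fun_eq_iff)
qed

text \<open>By Newton's expansion the \<open>j\<close>-th sum is the increment of
  \<open>(diff_op ^^ j) g\<close> from \<open>0\<close> to \<open>t\<close>. These increments are
  the Newton coefficients of the shift of \<open>g\<close> by \<open>t\<close> minus
  \<open>g\<close>, and they determine that difference.\<close>

lemma is_period_iff_diff_op_pow_at_zero:
  fixes g :: "nat \<Rightarrow> 'a :: comm_ring_1"
  shows "is_period g t \<longleftrightarrow>
    t \<ge> 1 \<and> (\<forall>j. (\<Sum>i=1..t. of_nat (t choose i) * (diff_op ^^ (i + j)) g 0) = 0)"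
proof -
  have eq: "(\<Sum>i=1..t. of_nat (t choose i) * (diff_op ^^ (i + j)) g 0)
      = (diff_op ^^ j) g t - (diff_op ^^ j) g 0" for j
  proof -
    have "(diff_op ^^ j) g t = (\<Sum>i\<le>t. of_nat (t choose i) * (diff_op ^^ (i + j)) g 0)"
      by (subst newton_expansion) (simp add: funpow_add)
    also have "\<dots> = (diff_op ^^ j) g 0 + (\<Sum>i=1..t. of_nat (t choose i) * (diff_op ^^ (i + j)) g 0)"
      by (simp add: atMost_atLeast0 sum.atLeast_Suc_atMost)
    finally show ?thesis by simp
  qed
  have "(\<forall>n. g (n + t) = g n) \<longleftrightarrow> (\<forall>j. (diff_op ^^ j) g t = (diff_op ^^ j) g 0)"
  proof
    assume "\<forall>n. g (n + t) = g n"
    then have "(\<lambda>n. g (n + t)) = g" by auto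
    then show "\<forall>j. (diff_op ^^ j) g t = (diff_op ^^ j) g 0"
      using diff_op_pow_shift[of _ g t] by (metis add_0)
  next
    assume *: "\<forall>j. (diff_op ^^ j) g t = (diff_op ^^ j) g 0"
    show "\<forall>n. g (n + t) = g n"
    proof
      fix n
      have "g (n + t) = (\<Sum>i\<le>n. of_nat (n choose i) * (diff_op ^^ i) (\<lambda>n. g (n + t)) 0)"
        by (rule newton_expansion)
      also have "\<dots> = (\<Sum>i\<le>n. of_nat (n choose i) * (diff_op ^^ i) g 0)"
        by (simp add: diff_op_pow_shift *)
      also have "\<dots> = g n" by (rule newton_expansion[symmetric])
      finally show "g (n + t) = g n" .
    qed
  qed
  then show ?thesis by (simp only: is_period_def eq right_minus_eq)
qed

text \<open>Along each period \<open>t\<close> of \<open>g\<close> the sum grows by the same amount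
  \<open>sum_op g t\<close>; after \<open>CARD('m)\<close> periods the total growth is
  \<open>0\<close> in the ring.\<close>

lemma periodic_seqs_sum_op:
  fixes g :: "nat \<Rightarrow> 'm :: nontriv mod_ring"
  assumes "g \<in> periodic_seqs"
  shows "sum_op g \<in> periodic_seqs"
proof -
  obtain t where t: "t \<ge> 1" "\<And>n. g (n + t) = g n"
    using assms by (auto simp: periodic_seqs_def is_period_def)
  have step: "sum_op g (n + t) = sum_op g n + sum_op g t" for n
    by (induction n) (simp_all add: t)
  have "sum_op g (n + q * t) = sum_op g n + of_nat q * sum_op g t" for n q
  proof (induction q)
    case (Suc q)
    have "n + Suc q * t = (n + q * t) + t" by simp
    then show ?case by (simp only: step Suc) (simp add: algebra_simps)
  qed simp
  moreover have "(of_nat CARD('m) :: 'm mod_ring) = 0"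
    by (rule of_nat_card_eq_0)
  ultimately have "is_period (sum_op g) (CARD('m) * t)"
    using t by (simp add: is_period_def)
  then show ?thesis by (auto simp: periodic_seqs_def)
qed

lemma periodic_seqs_sum_op_pow:
  fixes g :: "nat \<Rightarrow> 'm :: nontriv mod_ring"
  assumes "g \<in> periodic_seqs"
  shows "(sum_op ^^ k) g \<in> periodic_seqs"
  by (induction k) (simp_all add: assms periodic_seqs_sum_op)

lemma periodic_seqs_diff:
  fixes a b :: "nat \<Rightarrow> 'a :: ab_group_add"
  assumes "a \<in> periodic_seqs" "b \<in> periodic_seqs"
  shows "(\<lambda>n. a n - b n) \<in> periodic_seqs"
proof -
  obtain t u where "is_period a t" "is_period b u"
    using assms by (auto simp: periodic_seqs_def)
  then have "is_period a (t * u)" "is_period b (u * t)"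
    using is_period_mult by (metis is_period_def)+
  then have "is_period (\<lambda>n. a n - b n) (t * u)"
    by (simp add: is_period_def mult.commute)
  then show ?thesis by (auto simp: periodic_seqs_def)
qed

section \<open>The idempotent-nilpotent decomposition\<close>

text \<open>One power \<open>N\<close> of \<open>diff_op\<close> fixes both idempotent parts and
  annihilates both nilpotent parts; applied to the equation, it leaves
  \<open>a = a'\<close>.\<close>

lemma idempotent_nilpotent_parts_unique:
  assumes "idempotent_seq a" "nilpotent_seq b" "idempotent_seq a'" "nilpotent_seq b'"
    and eq: "\<And>n. a n + b n = a' n + b' n"
  shows "a' = a \<and> b' = b"
proof -
  obtain k k' where k: "k \<ge> 1" "(diff_op ^^ k) a = a" "k' \<ge> 1" "(diff_op ^^ k') a' = a'"
    using assms by (auto simp: idempotent_seq_def)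
  obtain i i' where i: "(diff_op ^^ i) b = const_seq 0" "(diff_op ^^ i') b' = const_seq 0"
    using assms by (auto simp: nilpotent_seq_def)
  \<comment> \<open>A common multiple of the idempotency exponents \<open>k\<close> and
    \<open>k'\<close> that is at least \<open>i\<close> and \<open>i'\<close>.\<close>
  define N where "N = k * k' * (i + i')"
  have "1 * 1 * (i + i') \<le> N"
    unfolding N_def using k(1,3) by (intro mult_le_mono) auto
  then have N: "i \<le> N" "i' \<le> N" by simp_all
  have "(diff_op ^^ N) a = a"
    using diff_op_pow_mult[OF k(2), of "k' * (i + i')"] by (simp add: N_def mult.assoc)
  moreover have "(diff_op ^^ N) a' = a'"
    using diff_op_pow_mult[OF k(4), of "k * (i + i')"] by (simp add: N_def mult.assoc mult.left_commute)
  moreover have "(diff_op ^^ N) b = const_seq 0" "(diff_op ^^ N) b' = const_seq 0"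
    using i N diff_op_pow_eq_zero_mono by blast+
  moreover have "(diff_op ^^ N) (\<lambda>n. a n + b n) = (diff_op ^^ N) (\<lambda>n. a' n + b' n)"
    by (simp add: eq)
  ultimately have "a' = a"
    by (simp add: diff_op_pow_add const_seq_def fun_eq_iff)
  then show ?thesis using eq by (simp add: fun_eq_iff)
qed

lemma idempotent_seq_shift: "idempotent_seq a \<Longrightarrow> idempotent_seq (\<lambda>n. a (n + t))"
  unfolding idempotent_seq_def by (metis diff_op_pow_shift)

lemma nilpotent_seq_shift: "nilpotent_seq b \<Longrightarrow> nilpotent_seq (\<lambda>n. b (n + t))"
  unfolding nilpotent_seq_def by (auto simp: diff_op_pow_shift const_seq_def)

text \<open>Shifting by a period of \<open>h\<close> turns its decomposition into another one of
  \<open>h\<close>; by uniqueness both parts are fixed by the shift.\<close>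

lemma is_period_decomposition:
  assumes "decomposes_into h a b"
  shows "is_period h t \<longleftrightarrow> is_period a t \<and> is_period b t"
proof
  assume h: "is_period h t"
  have "(\<lambda>n. a (n + t)) = a \<and> (\<lambda>n. b (n + t)) = b"
  proof (rule idempotent_nilpotent_parts_unique)
    show "a n + b n = a (n + t) + b (n + t)" for n
      using h assms by (simp add: is_period_def decomposes_into_def)
  qed (use assms in \<open>auto simp: decomposes_into_def intro: idempotent_seq_shift nilpotent_seq_shift\<close>)
  then show "is_period a t \<and> is_period b t"
    using h by (simp add: is_period_def fun_eq_iff)
next
  assume "is_period a t \<and> is_period b t"
  then show "is_period h t"
    using assms by (simp add: is_period_def decomposes_into_def)
qed

lemma is_the_decompositionI:
  assumes "decomposes_into h a b"
  shows "is_the_decomposition h a b"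
  unfolding is_the_decomposition_def
proof (intro conjI assms allI impI)
  fix a' b' assume "decomposes_into h a' b'"
  then have ab: "idempotent_seq a" "nilpotent_seq b" "idempotent_seq a'" "nilpotent_seq b'"
    and "h = (\<lambda>n. a n + b n)" "h = (\<lambda>n. a' n + b' n)"
    using assms by (simp_all add: decomposes_into_def)
  then have "a n + b n = a' n + b' n" for n by metis
  then have "a' = a \<and> b' = b" by (rule idempotent_nilpotent_parts_unique[OF ab])
  then show "a' = a" "b' = b" by simp_all
qed

section \<open>Binomial coefficients of prime powers\<close>

text \<open>In \<open>i * (p ^ a choose i) = p ^ a * ((p ^ a - 1) choose (i - 1))\<close> the factor
  \<open>i\<close> absorbs at most \<open>p ^ b\<close>. For \<open>b \<ge> a\<close> the truncated
  exponent is \<open>0\<close>.\<close>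

lemma prime_power_dvd_choose:
  fixes p :: nat
  assumes "prime p" and "i \<ge> 1" and "\<not> p ^ Suc b dvd i"
  shows "p ^ (a - b) dvd p ^ a choose i"
proof -
  define u where "u = multiplicity p i"
  obtain w where w: "i = p ^ u * w" "\<not> p dvd w"
    using multiplicity_decompose'[of i p] assms(1,2) unfolding u_def
    by (metis not_one_le_zero not_prime_unit)
  have ub: "u \<le> b"
    using assms(3) w(1) by (meson dvd_triv_left dvd_trans le_imp_power_dvd not_less_eq_eq)
  have "i * (p ^ a choose i) = p ^ a * ((p ^ a - 1) choose (i - 1))"
    using assms(1,2) by (simp add: times_binomial_minus1_eq)
  then have "p ^ a dvd p ^ u * (w * (p ^ a choose i))"
    by (metis dvd_triv_left mult.assoc w(1))
  then have "p ^ (a - u) dvd w * (p ^ a choose i)"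
  proof (cases "u \<le> a")
    case True
    then have "p ^ a = p ^ u * p ^ (a - u)" by (simp flip: power_add)
    then show ?thesis
      using \<open>p ^ a dvd _\<close> assms(1) by (simp add: prime_gt_0_nat)
  qed simp
  moreover have "coprime (p ^ (a - u)) w"
    using assms(1) w(2) by (simp add: prime_imp_coprime)
  ultimately have "p ^ (a - u) dvd p ^ a choose i"
    by (simp add: coprime_dvd_mult_right_iff)
  then show ?thesis
    using ub by (meson diff_le_mono2 dvd_trans le_imp_power_dvd)
qed

text \<open>Neighbouring entries of row \<open>p ^ a - 1\<close> of Pascal's triangle add up to an
  inner entry of row \<open>p ^ a\<close>, a multiple of \<open>p\<close>. Hence indivisibility
  passes on from the first entry, which is \<open>1\<close>.\<close>

lemma prime_not_dvd_choose_prime_power_minus_one: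
  fixes p :: nat
  assumes "prime p" and "j < p ^ a"
  shows "\<not> p dvd (p ^ a - 1) choose j"
  using assms(2)
proof (induction j)
  case 0
  then show ?case using assms(1) by (simp add: prime_nat_iff)
next
  case (Suc j)
  then have a: "a > 0" by (cases a) auto
  have "\<not> p ^ Suc (a - 1) dvd Suc j"
    using Suc.prems a by (auto dest: dvd_imp_le)
  then have "p ^ (a - (a - 1)) dvd p ^ a choose Suc j"
    using assms(1) by (intro prime_power_dvd_choose) auto
  then have "p dvd p ^ a choose Suc j" using a by simp
  moreover have "p ^ a choose Suc j = ((p ^ a - 1) choose j) + ((p ^ a - 1) choose Suc j)"
    using assms(1) by (metis Suc_diff_1 binomial_Suc_Suc prime_gt_0_nat zero_less_power)
  ultimately show ?case
    using Suc by (metis Suc_lessD dvd_add_left_iff)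
qed

text \<open>Exhibits the exact power of \<open>p\<close> in the binomial coefficient, since the
  cofactor is prime to \<open>p\<close> by the preceding lemma.\<close>

lemma choose_prime_power_prime_power:
  fixes p :: nat
  assumes "prime p"
  shows "(p ^ (b + r)) choose (p ^ r) = p ^ b * ((p ^ (b + r) - 1) choose (p ^ r - 1))"
proof -
  have "p ^ r * ((p ^ (b + r)) choose (p ^ r)) = p ^ (b + r) * ((p ^ (b + r) - 1) choose (p ^ r - 1))"
    using assms by (simp add: times_binomial_minus1_eq prime_gt_0_nat)
  also have "\<dots> = p ^ r * (p ^ b * ((p ^ (b + r) - 1) choose (p ^ r - 1)))"
    by (simp add: power_add)
  finally show ?thesis using assms by (simp add: prime_gt_0_nat)
qed

section \<open>The minimal period of a nilpotent sequence\<close>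

lemma of_int_mod_ring_eq_0_iff:
  "(of_int x :: 'm :: nontriv mod_ring) = 0 \<longleftrightarrow> int CARD('m) dvd x"
  by (simp add: of_int_eq_0_iff_char_dvd)

text \<open>
  The binomial coefficient \<open>p ^ a choose i\<close> has valuation \<open>a - v(i)\<close>. Hence in the coefficient sums
  of \<open>is_period_iff_diff_op_pow_at_zero\<close> every summand vanishes for \<open>t = p ^ (l - v + r)\<close>, whereas
  for \<open>t = p ^ (l - v + r - 1)\<close> and \<open>j = k - p ^ r\<close> exactly the summand \<open>i = p ^ r\<close> survives. The gap
  condition \<open>w \<le> p ^ r\<close> keeps the next power of \<open>p\<close> out of the range of nonzero coefficients.
\<close>

lemma min_period_leading_coefficient:
  fixes h :: "nat \<Rightarrow> 'm :: nontriv mod_ring" and c :: "nat \<Rightarrow> int"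
  assumes p: "prime p" and card: "CARD('m) = p ^ l" and v: "v < l"
    and coeff: "\<And>i. (diff_op ^^ i) h 0 = of_int (c i)"
    and all: "\<And>i. int p ^ v dvd c i"
    and above: "\<And>i. i > k \<Longrightarrow> int p ^ Suc v dvd c i"
    and lead: "\<not> int p ^ Suc v dvd c k"
    and zero: "\<And>i. i \<ge> k + w \<Longrightarrow> c i = 0"
    and r: "p ^ r \<le> k" "k < p ^ Suc r" "w \<le> p ^ r"
  shows "min_period h = p ^ (l - v + r)"
proof -
  \<comment> \<open>The claimed exponent is \<open>Suc (m + r)\<close>. A summand is divisible by
    \<open>p ^ l\<close> as soon as the binomial supplies \<open>Suc m\<close> and the coefficient
    \<open>v\<close> factors \<open>p\<close>, or \<open>m\<close> and \<open>Suc v\<close>.\<close>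
  define m where "m = l - Suc v"
  have l: "l = Suc m + v" using v by (simp add: m_def)
  have p2: "p \<ge> 2" using p by (rule prime_ge_2_nat)
  have period: "is_period h t \<longleftrightarrow>
      t \<ge> 1 \<and> (\<forall>j. int p ^ l dvd (\<Sum>i=1..t. int (t choose i) * c (i + j)))" for t
  proof -
    have "(\<Sum>i=1..t. of_nat (t choose i) * (diff_op ^^ (i + j)) h 0)
        = of_int (\<Sum>i=1..t. int (t choose i) * c (i + j))" for j
      by (simp add: coeff)
    then show ?thesis
      by (simp only: is_period_iff_diff_op_pow_at_zero of_int_mod_ring_eq_0_iff card of_nat_power)
  qed
  have choose_dvd: "int p ^ (a - b) dvd int (p ^ a choose i)"
    if "i \<ge> 1" "\<not> p ^ Suc b dvd i" for a b i
    using prime_power_dvd_choose[OF p that, of a] by (metis int_dvd_int_iff of_nat_power)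
  have "is_period h (p ^ Suc (m + r))"
    unfolding period
  proof (intro conjI allI dvd_sum)
    show "p ^ Suc (m + r) \<ge> 1" using p2 by simp
    fix j i assume "i \<in> {1..p ^ Suc (m + r)}"
    then have i: "i \<ge> 1" by simp
    consider "\<not> p ^ Suc r dvd i" | "p ^ Suc r dvd i" "\<not> p ^ Suc (Suc r) dvd i"
      | "p ^ Suc (Suc r) dvd i" by blast
    then show "int p ^ l dvd int (p ^ Suc (m + r) choose i) * c (i + j)"
    proof cases
      case 1
      then have "int p ^ Suc m dvd int (p ^ Suc (m + r) choose i)"
        using choose_dvd[OF i, of r "Suc (m + r)"] by (simp add: Suc_diff_le)
      then show ?thesis unfolding l power_add by (rule mult_dvd_mono) (rule all)
    next
      case 2
      then have "int p ^ m dvd int (p ^ Suc (m + r) choose i)"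
        using choose_dvd[OF i, of "Suc r" "Suc (m + r)"] by simp
      moreover have "i + j > k" using dvd_imp_le[OF 2(1)] i r(2) by linarith
      ultimately have "int p ^ m * int p ^ Suc v dvd int (p ^ Suc (m + r) choose i) * c (i + j)"
        by (intro mult_dvd_mono above)
      then show ?thesis by (simp add: l power_add mult_ac)
    next
      case 3
      have "2 * p ^ Suc r \<le> p ^ Suc (Suc r)" using p2 by simp
      moreover have "p ^ r \<le> p ^ Suc r" using p2 by simp
      \<comment> \<open>Both \<open>k\<close> and \<open>w\<close> are at most
        \<open>p ^ Suc r\<close>, and \<open>i\<close> is at least twice that.\<close>
      ultimately have "i + j \<ge> k + w" using dvd_imp_le[OF 3] i r by linarith
      then show ?thesis by (simp add: zero)
    qed
  qed
  moreover have "\<not> is_period h (p ^ (m + r))"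
  proof
    define j where "j = k - p ^ r"
    let ?g = "\<lambda>i. int (p ^ (m + r) choose i) * c (i + j)"
    assume "is_period h (p ^ (m + r))"
    then have sum: "int p ^ l dvd (\<Sum>i=1..p ^ (m + r). ?g i)"
      by (simp only: period)
    have "int p ^ l dvd (\<Sum>i\<in>{1..p ^ (m + r)} - {p ^ r}. ?g i)"
    proof (intro dvd_sum)
      fix i assume "i \<in> {1..p ^ (m + r)} - {p ^ r}"
      then have i: "i \<ge> 1" "i \<noteq> p ^ r" by auto
      consider "\<not> p ^ r dvd i" | "p ^ r dvd i" "\<not> p ^ Suc r dvd i" | "p ^ Suc r dvd i" by blast
      then show "int p ^ l dvd ?g i"
      proof cases
        case 1
        \<comment> \<open>Since \<open>p ^ 0\<close> divides \<open>i\<close>, \<open>r\<close> is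
          positive; \<open>i\<close> contains at most \<open>r'\<close> factors \<open>p\<close>,
          which leaves \<open>Suc m\<close> of them to the binomial.\<close>
        then obtain r' where r': "r = Suc r'" by (cases r) auto
        then have "int p ^ Suc m dvd int (p ^ (m + r) choose i)"
          using choose_dvd[OF i(1), of r' "m + r"] 1 by (simp add: Suc_diff_le)
        then show ?thesis unfolding l power_add by (rule mult_dvd_mono) (rule all)
      next
        case 2
        then have "int p ^ m dvd int (p ^ (m + r) choose i)"
          using choose_dvd[OF i(1), of r "m + r"] by simp
        moreover have "i + j > k" using dvd_imp_le[OF 2(1)] i r(1) unfolding j_def by linarith
        ultimately have "int p ^ m * int p ^ Suc v dvd ?g i"
          by (intro mult_dvd_mono above)
        then show ?thesis by (simp add: l power_add mult_ac)
      next
        case 3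
        have "2 * p ^ r \<le> p ^ Suc r" using p2 by simp
        \<comment> \<open>Here \<open>i \<ge> 2 * p ^ r\<close> and \<open>j = k - p ^ r\<close>, so
          \<open>i + j \<ge> k + p ^ r\<close>; this is where the gap condition
          \<open>w \<le> p ^ r\<close> enters.\<close>
        then have "i + j \<ge> k + w" using dvd_imp_le[OF 3] i r unfolding j_def by linarith
        then show ?thesis by (simp add: zero)
      qed
    qed
    moreover have "(\<Sum>i=1..p ^ (m + r). ?g i) = ?g (p ^ r) + (\<Sum>i\<in>{1..p ^ (m + r)} - {p ^ r}. ?g i)"
      using p2 by (intro sum.remove) (auto simp: Suc_le_eq intro: power_increasing)
    ultimately have "int p ^ l dvd ?g (p ^ r)"
      using sum by (simp only: dvd_add_left_iff)
    moreover define B where "B = (p ^ (m + r) - 1) choose (p ^ r - 1)"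
    have "?g (p ^ r) = int p ^ m * (int B * c k)"
      using r(1) choose_prime_power_prime_power[OF p, of m r] by (simp add: j_def B_def)
    moreover have "int p ^ l = int p ^ m * int p ^ Suc v" by (simp add: l power_add)
    ultimately have "int p ^ m * int p ^ Suc v dvd int p ^ m * (int B * c k)" by simp
    then have "int p ^ Suc v dvd int B * c k"
      using p2 by (subst (asm) dvd_mult_cancel_left) auto
    moreover have "coprime (int p ^ Suc v) (int B)"
    proof -
      have "\<not> p dvd B" unfolding B_def
      proof (rule prime_not_dvd_choose_prime_power_minus_one[OF p])
        have "p ^ r \<le> p ^ (m + r)" using p2 by (intro power_increasing) auto
        moreover have "p ^ r > 0" using p2 by simp
        ultimately show "p ^ r - 1 < p ^ (m + r)" by linarith
      qed
      then have "coprime p B" using p by (simp add: prime_imp_coprime)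
      then show ?thesis by simp
    qed
    ultimately show False using lead by (simp only: coprime_dvd_mult_right_iff)
  qed
  ultimately have "min_period h = p ^ Suc (m + r)"
    using p by (intro min_period_eq_prime_power)
  moreover have "Suc (m + r) = l - v + r" using l by simp
  ultimately show ?thesis by simp
qed

section \<open>Iterated sums of an idempotent sequence\<close>

lemma residue_less: "k \<ge> 1 \<Longrightarrow> residue k z < k"
  by (simp add: residue_def nat_less_iff)

text \<open>On the last \<open>k\<close> indices below \<open>s\<close>, adding \<open>k\<close>
  once brings \<open>i - s\<close> into the range of remainders; there the generating vector is run
  through once, in order.\<close>

lemma residue_of_nat_diff:
  assumes "i < s" and "s \<le> i + k"
  shows "residue k (int i - int s) = i + k - s"
proof -
  have "(int i - int s) mod int k = (int i - int s + int k) mod int k" by simp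
  also have "\<dots> = int i - int s + int k" using assms by (intro mod_pos_pos_trivial) auto
  finally show ?thesis using assms by (simp add: residue_def)
qed

text \<open>As \<open>diff_op ^^ k\<close> fixes \<open>g\<close>, powers of \<open>diff_op\<close>
  on \<open>g\<close> make sense for all integer exponents; this is their law of exponents.\<close>

lemma diff_op_pow_residue:
  assumes "k \<ge> 1" and "(diff_op ^^ k) g = g"
  shows "(diff_op ^^ i) ((diff_op ^^ residue k z) g) = (diff_op ^^ residue k (z + int i)) g"
proof -
  have "int ((i + residue k z) mod k) = (int i + z mod int k) mod int k"
    using assms(1) by (simp add: residue_def zmod_int)
  also have "\<dots> = (z + int i) mod int k"
    by (simp add: mod_simps add.commute)
  finally have "(i + residue k z) mod k = residue k (z + int i)"
    by (simp add: residue_def flip: nat_int)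
  then have "(diff_op ^^ residue k (z + int i)) g = (diff_op ^^ (i + residue k z)) g"
    using diff_op_pow_mod[OF assms(2)] by metis
  then show ?thesis by (simp add: funpow_add)
qed

text \<open>
  Since \<open>sum_op (diff_op g)\<close> is \<open>g\<close> minus the constant \<open>g 0\<close>, each application of \<open>sum_op\<close> lowers the
  exponent of \<open>diff_op\<close> by one modulo \<open>k\<close> and splits off one more constant.
\<close>

lemma sum_op_pow_idempotent:
  assumes "k \<ge> 1" and "(diff_op ^^ k) g = g"
  shows "(sum_op ^^ s) g n = (diff_op ^^ residue k (- int s)) g n
    - (\<Sum>j<s. (sum_op ^^ j) (const_seq ((diff_op ^^ residue k (int j - int s)) g 0)) n)"
proof (induction s arbitrary: n)
  case 0
  then show ?case by (simp add: residue_def)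
next
  case (Suc s)
  let ?d = "\<lambda>z. (diff_op ^^ residue k z) g"
  have "diff_op (?d (- int (Suc s))) = ?d (- int s)"
    using diff_op_pow_residue[OF assms, of 1 "- int (Suc s)"] by simp
  then have d: "sum_op (?d (- int s)) n = ?d (- int (Suc s)) n - ?d (- int (Suc s)) 0"
    by (metis sum_diff_op)
  have "(sum_op ^^ s) g = (\<lambda>n. ?d (- int s) n
      - (\<Sum>j<s. (sum_op ^^ j) (const_seq (?d (int j - int s) 0)) n))"
    using Suc by (rule ext)
  then have "(sum_op ^^ Suc s) g n = sum_op (?d (- int s)) n
      - (\<Sum>j<s. (sum_op ^^ Suc j) (const_seq (?d (int j - int s) 0)) n)"
    by (simp add: sum_op_diff sum_op_sum)
  also have "(\<Sum>j<s. (sum_op ^^ Suc j) (const_seq (?d (int j - int s) 0)) n)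
      = (\<Sum>j<s. (sum_op ^^ Suc j) (const_seq (?d (int (Suc j) - int (Suc s)) 0)) n)"
    by simp
  \<comment> \<open>The summand added for \<open>j = 0\<close> is the constant that
    \<open>sum_diff_op\<close> splits off.\<close>
  also have "\<dots> = (\<Sum>j<Suc s. (sum_op ^^ j) (const_seq (?d (int j - int (Suc s)) 0)) n)
      - ?d (- int (Suc s)) 0"
    by (simp only: sum.lessThan_Suc_shift) (simp add: const_seq_def)
  finally show ?case by (simp add: d)
qed

lemma idempotency_index:
  assumes "idempotent_seq g"
  shows "idempotency_index g \<ge> 1" and "(diff_op ^^ idempotency_index g) g = g"
  using LeastI_ex[of "\<lambda>k. k \<ge> 1 \<and> (diff_op ^^ k) g = g"] assms
  by (auto simp: idempotent_seq_def idempotency_index_def)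

lemma periodic_seqs_diff_op_pow:
  "g \<in> periodic_seqs \<Longrightarrow> (diff_op ^^ k) g \<in> periodic_seqs"
  unfolding periodic_seqs_def by (auto intro: is_period_diff_op_pow)

text \<open>\<open>diff_op ^^ s\<close> sends both \<open>(sum_op ^^ s) g\<close> and
  \<open>a\<close> to \<open>g\<close>, so it annihilates their difference.\<close>

lemma decomposes_into_sum_op_pow:
  fixes g :: "nat \<Rightarrow> 'm :: nontriv mod_ring"
  assumes "g \<in> periodic_seqs" and "s \<ge> 1" and k: "k \<ge> 1" "(diff_op ^^ k) g = g"
  defines "a \<equiv> (diff_op ^^ residue k (- int s)) g"
  shows "decomposes_into ((sum_op ^^ s) g) a (\<lambda>n. (sum_op ^^ s) g n - a n)"
proof -
  have "(diff_op ^^ k) a = a"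
    using k unfolding a_def by (metis comp_apply funpow_add add.commute)
  then have "idempotent_seq a" using k(1) by (auto simp: idempotent_seq_def)
  moreover have "(diff_op ^^ s) a = g"
    unfolding a_def by (subst diff_op_pow_residue[OF k]) (simp add: residue_def)
  then have "(diff_op ^^ s) (\<lambda>n. (sum_op ^^ s) g n - a n) = const_seq 0"
    by (simp add: diff_op_pow_diff diff_op_pow_sum_op_pow const_seq_def)
  then have "nilpotent_seq (\<lambda>n. (sum_op ^^ s) g n - a n)"
    using assms(2) by (auto simp: nilpotent_seq_def)
  ultimately show ?thesis
    using assms(1) unfolding decomposes_into_def a_def
    by (auto intro!: periodic_seqs_sum_op_pow periodic_seqs_diff_op_pow periodic_seqs_diff)
qed

text \<open>For \<open>i < s\<close> the first term is still an iterated sum and vanishes at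
  \<open>0\<close>; for \<open>i \<ge> s\<close> both terms become
  \<open>(diff_op ^^ (i - s)) g\<close> and cancel.\<close>

lemma nilpotent_part_coefficient:
  assumes k: "k \<ge> 1" "(diff_op ^^ k) g = g"
  shows "(diff_op ^^ i) (\<lambda>n. (sum_op ^^ s) g n - (diff_op ^^ residue k (- int s)) g n) 0
    = (if i < s then - (diff_op ^^ residue k (int i - int s)) g 0 else 0)"
proof -
  have a: "(diff_op ^^ i) ((diff_op ^^ residue k (- int s)) g)
      = (diff_op ^^ residue k (int i - int s)) g"
    by (simp add: diff_op_pow_residue[OF k])
  show ?thesis
  proof (cases "i < s")
    case True
    then show ?thesis
      by (simp add: diff_op_pow_diff a diff_op_pow_sum_op_pow_le sum_op_pow_at_zero)
  next
    case False
    then have "int i - int s = int (i - s)" by simp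
    then have "residue k (int i - int s) = (i - s) mod k"
      by (simp only: residue_def flip: zmod_int)
    then show ?thesis
      using False by (simp add: diff_op_pow_diff a diff_op_pow_sum_op_pow_ge diff_op_pow_mod[OF k(2)])
  qed
qed

text \<open>\<open>diff_op\<close> preserves periods, and a further power of it leads from
  \<open>(diff_op ^^ i) g\<close> back to \<open>g\<close>.\<close>

lemma min_period_diff_op_pow:
  assumes k: "k \<ge> 1" "(diff_op ^^ k) g = g"
  shows "min_period ((diff_op ^^ i) g) = min_period g"
proof (rule min_period_cong)
  fix t
  have "i mod k < k" using k(1) by simp
  then have "(diff_op ^^ (k - i mod k)) ((diff_op ^^ (i mod k)) g) = g"
    using k(2) by (metis comp_apply funpow_add le_add_diff_inverse2 less_imp_le)
  then have "(diff_op ^^ (k - i mod k)) ((diff_op ^^ i) g) = g"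
    by (simp add: diff_op_pow_mod[OF k(2)])
  then show "is_period ((diff_op ^^ i) g) t \<longleftrightarrow> is_period g t"
    by (metis is_period_diff_op_pow)
qed

section \<open>Valuations of integer representatives and the period of the nilpotent part\<close>

lemma of_int_to_int_mod_ring: "(of_int (to_int_mod_ring x) :: 'm :: nontriv mod_ring) = x"
  by (simp add: of_int_of_int_mod_ring)

lemma power_dvd_to_int_mod_ring:
  fixes x :: "'m :: nontriv mod_ring"
  assumes "enat v \<le> padic_val p x"
  shows "int p ^ v dvd to_int_mod_ring x"
proof (cases "x = 0")
  case False
  then have "v \<le> multiplicity (int p) (to_int_mod_ring x)"
    using assms by (simp add: padic_val_def)
  then show ?thesis by (rule multiplicity_dvd')
qed simp

lemma not_power_dvd_to_int_mod_ring:
  fixes x :: "'m :: nontriv mod_ring"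
  assumes "prime p" and "padic_val p x = enat v"
  shows "\<not> int p ^ Suc v dvd to_int_mod_ring x"
proof -
  have "x \<noteq> 0" using assms(2) by (auto simp: padic_val_def)
  then have "to_int_mod_ring x \<noteq> 0" by simp
  moreover have "v = multiplicity (int p) (to_int_mod_ring x)"
    using assms(2) \<open>x \<noteq> 0\<close> by (simp add: padic_val_def)
  moreover have "\<not> is_unit (int p)" using assms(1) by (metis not_prime_unit prime_nat_int_transfer)
  ultimately show ?thesis by (simp add: power_dvd_iff_le_multiplicity del: power_Suc)
qed

text \<open>If \<open>e ! \<gamma>\<close> is nonzero, both sequences have their last Newton
  coefficient of minimal valuation at the same index and with the same valuation, so
  \<open>min_period_leading_coefficient\<close> yields the same prime power for both.\<close>

lemma min_period_nilpotent_part: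
  fixes g :: "nat \<Rightarrow> 'm :: nontriv mod_ring"
  assumes p: "prime p" and card: "CARD('m) = p ^ l"
    and k: "k \<ge> 1" "(diff_op ^^ k) g = g"
    and e: "e = map (\<lambda>i. (diff_op ^^ i) g 0) [0..<k]"
    and lead: "is_leading_index p e \<gamma>"
    and s: "s \<ge> k + p ^ k"
  shows "min_period (\<lambda>n. (sum_op ^^ s) g n - (diff_op ^^ residue k (- int s)) g n)
    = min_period ((sum_op ^^ (s - k + \<gamma>)) (const_seq (e ! \<gamma>)))"
    (is "min_period ?b = min_period ?c")
proof -
  \<comment> \<open>The last index below \<open>s\<close> at which \<open>e ! \<gamma>\<close>
    occurs, up to sign, as a coefficient of the nilpotent part.\<close>
  define q where "q = s - k + \<gamma>"
  have len: "length e = k" by (simp add: e)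
  have \<gamma>: "\<gamma> < k" and min: "\<And>j. j < k \<Longrightarrow> padic_val p (e ! \<gamma>) \<le> padic_val p (e ! j)"
    and last: "\<And>j. has_minimal_val p e j \<Longrightarrow> j \<le> \<gamma>"
    using lead by (auto simp: is_leading_index_def has_minimal_val_def len)
  have q: "q < s" "s \<le> q + k" "p ^ k \<le> q" using s \<gamma> by (auto simp: q_def)
  have nth: "e ! residue k z = (diff_op ^^ residue k z) g 0" for z
    using residue_less[OF k(1), of z] by (simp add: e)
  have b: "(diff_op ^^ i) ?b 0 = (if i < s then - e ! residue k (int i - int s) else 0)" for i
    by (simp add: nilpotent_part_coefficient[OF k] nth)
  have c: "(diff_op ^^ i) ?c 0 = (if i = q then e ! \<gamma> else 0)" for i
    by (simp add: diff_op_pow_sum_op_pow_const_at_zero q_def)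
  show ?thesis
  proof (cases "e ! \<gamma> = 0")
    \<comment> \<open>A minimal valuation of infinity forces all entries to be \<open>0\<close>;
      both sequences then have only zero coefficients.\<close>
    case True
    then have "e ! j = 0" if "j < k" for j
      using min[OF that] by (simp add: padic_val_def split: if_splits)
    then have "(diff_op ^^ i) ?b 0 = 0" "(diff_op ^^ i) ?c 0 = 0" for i
      using residue_less[OF k(1)] True unfolding b c by auto
    then have "is_period ?b t \<longleftrightarrow> is_period ?c t" for t
      by (simp only: is_period_iff_diff_op_pow_at_zero)
    then show ?thesis by (rule min_period_cong)
  next
    case False
    define v where "v = multiplicity (int p) (to_int_mod_ring (e ! \<gamma>))"
    have v: "padic_val p (e ! \<gamma>) = enat v" using False by (simp add: padic_val_def v_def)
    have all: "int p ^ v dvd to_int_mod_ring (e ! j)" if "j < k" for j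
      using min[OF that] v by (intro power_dvd_to_int_mod_ring) simp
    have above: "int p ^ Suc v dvd to_int_mod_ring (e ! j)" if j: "j < k" "\<gamma> < j" for j
    proof (rule power_dvd_to_int_mod_ring)
      have "\<not> has_minimal_val p e j" using last[of j] j(2) by auto
      then obtain i where "i < k" "padic_val p (e ! i) < padic_val p (e ! j)"
        using j(1) by (auto simp: has_minimal_val_def len not_le)
      then have "enat v < padic_val p (e ! j)" using min[of i] v by (metis order_le_less_trans)
      then show "enat (Suc v) \<le> padic_val p (e ! j)" by (metis eSuc_enat ileI1)
    qed
    note not_dvd = not_power_dvd_to_int_mod_ring[OF p v]
    have "v < l"
    proof (rule ccontr)
      assume "\<not> v < l"
      then have "int p ^ l dvd to_int_mod_ring (e ! \<gamma>)"
        using all[OF \<gamma>] by (meson dvd_trans le_imp_power_dvd not_less)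
      then have "(of_int (to_int_mod_ring (e ! \<gamma>)) :: 'm mod_ring) = 0"
        by (simp add: of_int_mod_ring_eq_0_iff card)
      then show False using False by (simp add: of_int_to_int_mod_ring)
    qed
    have p2: "p \<ge> 2" using p by (rule prime_ge_2_nat)
    have "1 \<le> p ^ k" using p2 by simp
    then have "q \<ge> 1" using q(3) by linarith
    then obtain r where r: "p ^ r \<le> q" "q < p ^ Suc r"
      using ex_power_ivl1[OF p2] by auto
    \<comment> \<open>The bound on \<open>s\<close> serves this step: \<open>q \<ge> p ^ k\<close>
      gives \<open>k \<le> r < p ^ r\<close>, the gap condition for \<open>w = k\<close>.\<close>
    have "k \<le> r"
    proof (rule ccontr)
      assume "\<not> k \<le> r"
      then have "p ^ Suc r \<le> p ^ k" using p2 by (intro power_increasing) auto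
      then show False using r q(3) by simp
    qed
    moreover have "r < p ^ r" using p2 by (intro power_gt_expt) simp
    ultimately have kr: "k \<le> p ^ r" by simp
    have "min_period ?b = p ^ (l - v + r)"
    proof (rule min_period_leading_coefficient[OF p card \<open>v < l\<close> _ _ _ _ _ r kr])
      let ?c = "\<lambda>i. if i < s then - to_int_mod_ring (e ! residue k (int i - int s)) else 0"
      show "(diff_op ^^ i) ?b 0 = of_int (?c i)" for i
        unfolding b by (simp add: of_int_to_int_mod_ring)
      show "int p ^ v dvd ?c i" for i
        using all[OF residue_less[OF k(1)]] by simp
      show "int p ^ Suc v dvd ?c i" if "i > q" for i
      \<comment> \<open>Between \<open>q\<close> and \<open>s\<close> only entries with index above
        \<open>\<gamma>\<close> occur, and these have larger valuation.\<close>
      proof (cases "i < s")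
        case True
        then have "residue k (int i - int s) = i + k - s"
          using that q by (intro residue_of_nat_diff) auto
        moreover have "i + k - s < k" "\<gamma> < i + k - s" using True that s by (auto simp: q_def)
        ultimately show ?thesis using above True by (simp del: power_Suc)
      qed simp
      have "residue k (int q - int s) = \<gamma>"
        using q(1,2) \<gamma> s by (subst residue_of_nat_diff) (auto simp: q_def)
      then show "\<not> int p ^ Suc v dvd ?c q" using not_dvd q(1) by (simp del: power_Suc)
      show "?c i = 0" if "i \<ge> q + k" for i using that q(2) by simp
    qed
    moreover have "min_period ?c = p ^ (l - v + r)"
    proof (rule min_period_leading_coefficient[OF p card \<open>v < l\<close> _ _ _ _ _ r kr])
      let ?d = "\<lambda>i. if i = q then to_int_mod_ring (e ! \<gamma>) else 0"
      show "(diff_op ^^ i) ?c 0 = of_int (?d i)" for i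
        unfolding c by (simp add: of_int_to_int_mod_ring)
      show "int p ^ v dvd ?d i" for i using all[OF \<gamma>] by simp
      show "int p ^ Suc v dvd ?d i" if "i > q" for i using that by simp
      show "\<not> int p ^ Suc v dvd ?d q" using not_dvd by (simp del: power_Suc)
      show "?d i = 0" if "i \<ge> q + k" for i using that k(1) by simp
    qed
    ultimately show ?thesis by simp
  qed
qed

theorem theorem3p10:
  fixes p l \<eta> :: nat
    and f :: "nat \<Rightarrow> 'm :: nontriv mod_ring"
    and e :: "'m mod_ring list"
  assumes "prime p" and "l \<ge> 1" and "CARD('m) = p ^ l"
    and "f \<in> periodic_seqs"
    and "idempotent_seq f"
    and "\<eta> = idempotency_index f"
    and "e = generating_vector f"
  shows "(\<forall>s\<ge>1.
            (sum_op ^^ s) f =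
              (\<lambda>n. (diff_op ^^ residue \<eta> (- int s)) f n
                 - (\<Sum>j<s. (sum_op ^^ j) (const_seq (e ! residue \<eta> (int j - int s))) n)) \<and>
            is_the_decomposition ((sum_op ^^ s) f)
              ((diff_op ^^ residue \<eta> (- int s)) f)
              (\<lambda>n. - (\<Sum>j<s. (sum_op ^^ j) (const_seq (e ! residue \<eta> (int j - int s))) n))) \<and>
         (\<forall>\<gamma>. is_leading_index p e \<gamma> \<longrightarrow>
            (\<exists>s\<^sub>0\<ge>\<eta>. \<forall>s\<ge>s\<^sub>0.
               min_period ((sum_op ^^ s) f) =
                 lcm (min_period f)
                     (min_period ((sum_op ^^ (s - \<eta> + \<gamma>)) (const_seq (e ! \<gamma>))))))"
proof -
  have k: "\<eta> \<ge> 1" "(diff_op ^^ \<eta>) f = f"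
    using idempotency_index[OF \<open>idempotent_seq f\<close>] by (simp_all add: assms(6))
  have e: "e = map (\<lambda>i. (diff_op ^^ i) f 0) [0..<\<eta>]"
    by (simp add: assms(6,7) generating_vector_def)
  let ?a = "\<lambda>s. (diff_op ^^ residue \<eta> (- int s)) f"
  \<comment> \<open>As a difference the nilpotent part is easy to differentiate;
    \<open>formula\<close> identifies it with the explicit sum.\<close>
  let ?b = "\<lambda>s n. (sum_op ^^ s) f n - ?a s n"
  let ?S = "\<lambda>s n. \<Sum>j<s. (sum_op ^^ j) (const_seq (e ! residue \<eta> (int j - int s))) n"
  have "e ! residue \<eta> z = (diff_op ^^ residue \<eta> z) f 0" for z
    using residue_less[OF k(1), of z] by (simp add: e)
  then have formula: "(sum_op ^^ s) f n = ?a s n - ?S s n" for s n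
    by (simp add: sum_op_pow_idempotent[OF k, of s n])
  then have b: "?b s = (\<lambda>n. - ?S s n)" for s
    by (simp add: fun_eq_iff)
  have dec: "decomposes_into ((sum_op ^^ s) f) (?a s) (?b s)" if "s \<ge> 1" for s
    by (rule decomposes_into_sum_op_pow[OF assms(4) that k])
  \<comment> \<open>The threshold \<open>\<eta> + p ^ \<eta>\<close> serves as
    \<open>s\<^sub>0\<close> for every \<open>\<gamma>\<close>; being at least
    \<open>\<eta>\<close>, it keeps \<open>s - \<eta>\<close> from truncating.\<close>
  have "min_period ((sum_op ^^ s) f)
      = lcm (min_period f) (min_period ((sum_op ^^ (s - \<eta> + \<gamma>)) (const_seq (e ! \<gamma>))))"
    if "is_leading_index p e \<gamma>" "s \<ge> \<eta> + p ^ \<eta>" for \<gamma> s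
  proof -
    have "s \<ge> 1" using that(2) k(1) by simp
    note dec = dec[OF this]
    have "min_period ((sum_op ^^ s) f) = lcm (min_period (?a s)) (min_period (?b s))"
      using dec by (intro min_period_eq_lcm is_period_decomposition) (simp_all only: decomposes_into_def)
    then show ?thesis
      by (simp only: min_period_diff_op_pow[OF k]
          min_period_nilpotent_part[OF assms(1,3) k e that])
  qed
  then have "\<forall>\<gamma>. is_leading_index p e \<gamma> \<longrightarrow> (\<exists>s\<^sub>0\<ge>\<eta>. \<forall>s\<ge>s\<^sub>0.
      min_period ((sum_op ^^ s) f)
        = lcm (min_period f) (min_period ((sum_op ^^ (s - \<eta> + \<gamma>)) (const_seq (e ! \<gamma>)))))"
    by (meson le_add1)
  moreover have "(sum_op ^^ s) f = (\<lambda>n. ?a s n - ?S s n)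
      \<and> is_the_decomposition ((sum_op ^^ s) f) (?a s) (\<lambda>n. - ?S s n)" if "s \<ge> 1" for s
    using is_the_decompositionI[OF dec[OF that]] formula[of s] unfolding b by blast
  ultimately show ?thesis by blast
qed

end
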